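(* Let $m \geq 3$ and $n \geq 2$ be integers and let $G = U_{(n,m)} = \langle a, b : a^{2n} = b^m = 1,\ a^{-1}ba = b^{-1} \rangle$. Then $$M_1(\mathcal{CCC}(G)) = \begin{cases} \frac{1}{8}\left(16n(n-1)^2 + (mn-2n)(mn-2n-2)^2\right), & \text{when } m \text{ is even and } \frac{m}{2} \text{ is even} \\ \frac{1}{8}\left(16n(2n-1)^2 + (mn-2n)(mn-2n-2)^2\right), & \text{when } m \text{ is even and } \frac{m}{2} \text{ is odd} \\ \frac{1}{8}\left(8n(n-1)^2 + (mn-n)(mn-n-2)^2\right), & \text{when } m \text{ is odd} \end{cases}$$ and $$M_2(\mathcal{CCC}(G)) = \begin{cases} \frac{1}{32}\left(32n(n-1)^3 + (mn-2n)(mn-2n-2)^3\right), & \text{when } m \text{ is even and } \frac{m}{2} \text{ is even} \\ \frac{1}{32}\left(32n(2n-1)^3 + (mn-2n)(mn-2n-2)^3\right), & \text{when } m \text{ is even and } \frac{m}{2} \text{ is odd} \\ \frac{1}{32}\left(16n(n-1)^3 + (mn-n)(mn-n-2)^3\right), & \text{when } m \text{ is odd.} \end{cases}$$ Further, $\frac{M_2(\mathcal{CCC}(G))}{|e(\mathcal{CCC}(G))|} \geq \frac{M_1(\mathcal{CCC}(G))}{|v(\mathcal{CCC}(G))|}$, with equality when $m = 3, 4$ and $6$.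
   Context: For a finite group $G$ and $x \in G$, $x^G$ denotes the conjugacy class of $x$ in $G$. The commuting conjugacy class graph $\mathcal{CCC}(G)$ is the simple undirected graph whose vertices are the conjugacy classes of non-central elements of $G$, where two distinct vertices $x^G$ and $y^G$ are adjacent if and only if there exist $x' \in x^G$ and $y' \in y^G$ with $x'y' = y'x'$. For a finite simple graph $\Gamma$ with vertex set $v(\Gamma)$ and edge set $e(\Gamma)$, the first and second Zagreb indices are $M_1(\Gamma) = \sum_{v \in v(\Gamma)} \deg(v)^2$ and $M_2(\Gamma) = \sum_{uv \in e(\Gamma)} \deg(u)\deg(v)$. *)

theory Defs
  imports Complex_Main "HOL-Algebra.Coset"
begin

section \<open>Groups given by generators and relations\<close>

datatype 'g letter = Pos 'g | Neg 'g

type_synonym 'g word = "'g letter list"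

fun inv_letter :: "'g letter \<Rightarrow> 'g letter" where
  "inv_letter (Pos g) = Neg g"
| "inv_letter (Neg g) = Pos g"

text \<open>A relation u = v is the pair (u, v); the empty word stands for 1.
  All elements of the type of generators are generators.\<close>

inductive pres_eq :: "('g word \<times> 'g word) set \<Rightarrow> 'g word \<Rightarrow> 'g word \<Rightarrow> bool"
  for R where
  refl: "pres_eq R u u"
| sym: "pres_eq R u v \<Longrightarrow> pres_eq R v u"
| trans: "pres_eq R u v \<Longrightarrow> pres_eq R v w \<Longrightarrow> pres_eq R u w"
| append: "pres_eq R u u' \<Longrightarrow> pres_eq R v v' \<Longrightarrow> pres_eq R (u @ v) (u' @ v')"
| cancel: "pres_eq R [l, inv_letter l] []"
| relation: "(u, v) \<in> R \<Longrightarrow> pres_eq R u v"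

definition word_class :: "('g word \<times> 'g word) set \<Rightarrow> 'g word \<Rightarrow> 'g word set" where
  "word_class R u = {v. pres_eq R u v}"

definition presented_group :: "('g word \<times> 'g word) set \<Rightarrow> 'g word set monoid" where
  "presented_group R =
    \<lparr>carrier = range (word_class R),
     monoid.mult = (\<lambda>X Y. {w. \<exists>u\<in>X. \<exists>v\<in>Y. pres_eq R (u @ v) w}),
     one = word_class R []\<rparr>"

lemma word_class_eq_iff: "word_class R u = word_class R v \<longleftrightarrow> pres_eq R u v"
  unfolding word_class_def by (blast intro: pres_eq.intros)

lemma presented_group_mult:
  "word_class R u \<otimes>\<^bsub>presented_group R\<^esub> word_class R v = word_class R (u @ v)"
  unfolding word_class_def presented_group_def
  by (auto intro: pres_eq.intros)

lemma inv_letter_inv_letter [simp]: "inv_letter (inv_letter l) = l"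
  by (cases l) auto

lemma pres_eq_inverse_word: "pres_eq R (map inv_letter (rev u) @ u) []"
proof (induction u)
  case Nil
  show ?case by (simp add: pres_eq.refl)
next
  case (Cons l u)
  let ?v = "map inv_letter (rev u)"
  have "pres_eq R [inv_letter l, l] []"
    using pres_eq.cancel[of R "inv_letter l"] by simp
  hence "pres_eq R (?v @ [inv_letter l, l] @ u) (?v @ [] @ u)"
    by (intro pres_eq.append pres_eq.refl)
  with Cons.IH show ?case
    by (auto intro: pres_eq.trans)
qed

lemma presented_group_is_group: "group (presented_group R)"
proof (rule groupI)
  fix X assume "X \<in> carrier (presented_group R)"
  then obtain u where X: "X = word_class R u"
    by (auto simp: presented_group_def)
  have "word_class R (map inv_letter (rev u)) \<otimes>\<^bsub>presented_group R\<^esub> X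
      = \<one>\<^bsub>presented_group R\<^esub>"
    unfolding X presented_group_mult
    by (simp add: presented_group_def word_class_eq_iff pres_eq_inverse_word)
  thus "\<exists>Y\<in>carrier (presented_group R). Y \<otimes>\<^bsub>presented_group R\<^esub> X = \<one>\<^bsub>presented_group R\<^esub>"
    by (auto simp: presented_group_def)
next
  fix X Y assume "X \<in> carrier (presented_group R)" "Y \<in> carrier (presented_group R)"
  then obtain u v where "X = word_class R u" "Y = word_class R v"
    by (auto simp: presented_group_def)
  thus "X \<otimes>\<^bsub>presented_group R\<^esub> Y \<in> carrier (presented_group R)"
    by (simp add: presented_group_mult) (simp add: presented_group_def)
next
  fix X Y Z assume "X \<in> carrier (presented_group R)" "Y \<in> carrier (presented_group R)"
    "Z \<in> carrier (presented_group R)"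
  then obtain u v w where "X = word_class R u" "Y = word_class R v" "Z = word_class R w"
    by (auto simp: presented_group_def)
  thus "X \<otimes>\<^bsub>presented_group R\<^esub> Y \<otimes>\<^bsub>presented_group R\<^esub> Z
      = X \<otimes>\<^bsub>presented_group R\<^esub> (Y \<otimes>\<^bsub>presented_group R\<^esub> Z)"
    by (simp add: presented_group_mult)
next
  fix X assume "X \<in> carrier (presented_group R)"
  then obtain u where X: "X = word_class R u"
    by (auto simp: presented_group_def)
  have one: "\<one>\<^bsub>presented_group R\<^esub> = word_class R []"
    by (simp add: presented_group_def)
  show "\<one>\<^bsub>presented_group R\<^esub> \<otimes>\<^bsub>presented_group R\<^esub> X = X"
    unfolding X one by (simp add: presented_group_mult)
qed (simp add: presented_group_def)

primrec letter_value :: "('h, 'z) monoid_scheme \<Rightarrow> ('g \<Rightarrow> 'h) \<Rightarrow> 'g letter \<Rightarrow> 'h" where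
  "letter_value H f (Pos g) = f g"
| "letter_value H f (Neg g) = inv\<^bsub>H\<^esub> f g"

primrec word_value :: "('h, 'z) monoid_scheme \<Rightarrow> ('g \<Rightarrow> 'h) \<Rightarrow> 'g word \<Rightarrow> 'h" where
  "word_value H f [] = \<one>\<^bsub>H\<^esub>"
| "word_value H f (l # u) = letter_value H f l \<otimes>\<^bsub>H\<^esub> word_value H f u"

text \<open>Universal property (von Dyck).\<close>

lemma presented_group_universal:
  assumes "group H" and f: "range f \<subseteq> carrier H"
    and rel: "\<And>u v. (u, v) \<in> R \<Longrightarrow> word_value H f u = word_value H f v"
  shows "\<exists>h\<in>hom (presented_group R) H. \<forall>u. h (word_class R u) = word_value H f u"
proof -
  interpret H: group H by fact
  have letter: "letter_value H f l \<in> carrier H" for l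
    using f by (cases l) auto
  have closed: "word_value H f u \<in> carrier H" for u
    by (induction u) (auto simp: letter)
  have app: "word_value H f (u @ v) = word_value H f u \<otimes>\<^bsub>H\<^esub> word_value H f v" for u v
    by (induction u) (auto simp: letter closed H.m_assoc)
  have resp: "word_value H f u = word_value H f v" if "pres_eq R u v" for u v
    using that
  proof induction
    case (cancel l)
    have "f g \<in> carrier H" for g using f by auto
    then show ?case by (cases l) auto
  qed (auto simp: app rel)
  define h where "h X = word_value H f (SOME u. u \<in> X)" for X
  have h: "h (word_class R u) = word_value H f u" for u
  proof -
    have "u \<in> word_class R u" by (simp add: word_class_def pres_eq.refl)
    hence "(SOME v. v \<in> word_class R u) \<in> word_class R u" by (rule someI)
    hence "pres_eq R u (SOME v. v \<in> word_class R u)" by (simp add: word_class_def)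
    thus ?thesis unfolding h_def by (metis resp)
  qed
  have "h \<in> hom (presented_group R) H"
  proof (rule homI)
    fix X assume "X \<in> carrier (presented_group R)"
    thus "h X \<in> carrier H" by (auto simp: presented_group_def h closed)
  next
    fix X Y assume "X \<in> carrier (presented_group R)" "Y \<in> carrier (presented_group R)"
    then obtain u v where "X = word_class R u" "Y = word_class R v"
      by (auto simp: presented_group_def)
    thus "h (X \<otimes>\<^bsub>presented_group R\<^esub> Y) = h X \<otimes>\<^bsub>H\<^esub> h Y"
      by (simp add: presented_group_mult h app)
  qed
  thus ?thesis using h by blast
qed

datatype ab = gen_a | gen_b

definition U_relations :: "nat \<Rightarrow> nat \<Rightarrow> (ab word \<times> ab word) set" where
  "U_relations n m =
    {(replicate (2 * n) (Pos gen_a), []),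
     (replicate m (Pos gen_b), []),
     ([Neg gen_a, Pos gen_b, Pos gen_a], [Neg gen_b])}"

definition U_group :: "nat \<Rightarrow> nat \<Rightarrow> ab word set monoid" where
  "U_group n m = presented_group (U_relations n m)"


section \<open>Simple graphs and Zagreb indices\<close>

text \<open>Edges are two-element sets of vertices.\<close>

record 'v sgraph =
  verts :: "'v set"
  edges :: "'v set set"

definition deg :: "'v sgraph \<Rightarrow> 'v \<Rightarrow> nat" where
  "deg \<Gamma> v = card {e \<in> edges \<Gamma>. v \<in> e}"

definition zagreb1 :: "'v sgraph \<Rightarrow> nat" where
  "zagreb1 \<Gamma> = (\<Sum>v\<in>verts \<Gamma>. (deg \<Gamma> v)\<^sup>2)"

text \<open>For an edge e = {u, v} with distinct u and v, the inner product is deg u * deg v.\<close>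

definition zagreb2 :: "'v sgraph \<Rightarrow> nat" where
  "zagreb2 \<Gamma> = (\<Sum>e\<in>edges \<Gamma>. \<Prod>v\<in>e. deg \<Gamma> v)"


section \<open>The commuting conjugacy class graph\<close>

definition conj_class :: "('a, 'z) monoid_scheme \<Rightarrow> 'a \<Rightarrow> 'a set" where
  "conj_class G x = {g \<otimes>\<^bsub>G\<^esub> x \<otimes>\<^bsub>G\<^esub> inv\<^bsub>G\<^esub> g | g. g \<in> carrier G}"

definition group_center :: "('a, 'z) monoid_scheme \<Rightarrow> 'a set" where
  "group_center G = {z \<in> carrier G. \<forall>g\<in>carrier G. z \<otimes>\<^bsub>G\<^esub> g = g \<otimes>\<^bsub>G\<^esub> z}"

definition ccc_graph :: "('a, 'z) monoid_scheme \<Rightarrow> 'a set sgraph" where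
  "ccc_graph G =
    (let V = conj_class G ` (carrier G - group_center G)
     in \<lparr>verts = V,
         edges = {{X, Y} | X Y. X \<in> V \<and> Y \<in> V \<and> X \<noteq> Y \<and>
                    (\<exists>x\<in>X. \<exists>y\<in>Y. x \<otimes>\<^bsub>G\<^esub> y = y \<otimes>\<^bsub>G\<^esub> x)}\<rparr>)"

end

theory Submission
  imports Defs
begin

text \<open>
  In the group every element is $a^i b^j$, with $i$ modulo $2n$ and $j$ modulo $m$, and
  $a^i b^j a^k b^l = a^{i+k} b^{\pm j+l}$ where the sign is the parity of $k$. For even $i$ the class
  of $a^i b^j$ is $\{a^i b^j, a^i b^{-j}\}$; for odd $i$ it consists of all $a^i b^{j+2t}$. Elements
  with $i$ even commute with each other, but a noncentral one never commutes with an element with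
  $i$ odd; two elements with odd exponents of $a$ and exponents $j$, $l$ of $b$ commute iff $m$
  divides $2(j-l)$. Hence the graph is a disjoint union of cliques: one for the even exponents of
  $a$, and one for the odd exponents, or two if $4$ divides $m$ (then the parity of $j$ separates).

  When adjacent vertices have equal degree, double counting gives $2|e| = \sum_v d_v$ and
  $2 M_2 = \sum_v d_v^3$, so that the inequality is Chebyshev's sum inequality for $d$ and $d^2$.
\<close>

section \<open>Zagreb indices of graphs with regular components\<close>

text \<open>Both sides sum \<open>f v\<close> over all incident pairs of a vertex and an edge. The
  weight stays general: weight 1 counts the edges, and squared degrees lead to the second Zagreb
  index.\<close>

lemma handshake_weighted:
  assumes "finite (verts \<Gamma>)" and E: "\<And>e. e \<in> edges \<Gamma> \<Longrightarrow> e \<subseteq> verts \<Gamma>"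
  shows "(\<Sum>e\<in>edges \<Gamma>. \<Sum>v\<in>e. f v) = (\<Sum>v\<in>verts \<Gamma>. of_nat (deg \<Gamma> v) * (f v :: 'b :: comm_semiring_1))"
proof -
  have fin: "finite (edges \<Gamma>)"
    by (rule finite_subset[of _ "Pow (verts \<Gamma>)"]) (use assms in auto)
  have "(\<Sum>e\<in>edges \<Gamma>. \<Sum>v\<in>e. f v) = (\<Sum>e\<in>edges \<Gamma>. \<Sum>v | v \<in> verts \<Gamma> \<and> v \<in> e. f v)"
    by (intro sum.cong refl) (use E in auto)
  also have "\<dots> = (\<Sum>v\<in>verts \<Gamma>. \<Sum>e | e \<in> edges \<Gamma> \<and> v \<in> e. f v)"
    by (rule sum.swap_restrict) (use assms fin in auto)
  finally show ?thesis by (simp add: deg_def)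
qed

text \<open>If both ends of an edge have degree d, the edge contributes 1 + 1 = 2 to the count with
  weight 1, and d^2 + d^2 = 2 * (d * d) to the count with weight d^2.\<close>

lemma zagreb_regular_components:
  assumes fin: "finite (verts \<Gamma>)"
    and E: "\<And>e. e \<in> edges \<Gamma> \<Longrightarrow> \<exists>u v. e = {u, v} \<and> u \<noteq> v \<and> u \<in> verts \<Gamma> \<and> v \<in> verts \<Gamma> \<and> deg \<Gamma> u = deg \<Gamma> v"
  shows "2 * card (edges \<Gamma>) = (\<Sum>v\<in>verts \<Gamma>. deg \<Gamma> v)"
    and "2 * zagreb2 \<Gamma> = (\<Sum>v\<in>verts \<Gamma>. deg \<Gamma> v ^ 3)"
proof -
  have sub: "e \<subseteq> verts \<Gamma>" if "e \<in> edges \<Gamma>" for e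
    using E[OF that] by auto
  note H = handshake_weighted[OF fin sub, where 'b = nat]
  have "(\<Sum>e\<in>edges \<Gamma>. \<Sum>v\<in>e. (1::nat)) = (\<Sum>e\<in>edges \<Gamma>. 2)"
  proof (rule sum.cong[OF HOL.refl])
    fix e assume "e \<in> edges \<Gamma>"
    then obtain u v where "e = {u, v}" "u \<noteq> v"
      using E by blast
    thus "(\<Sum>v\<in>e. (1::nat)) = 2" by simp
  qed
  thus "2 * card (edges \<Gamma>) = (\<Sum>v\<in>verts \<Gamma>. deg \<Gamma> v)"
    using H[of "\<lambda>_. 1"] by simp
  have "(\<Sum>e\<in>edges \<Gamma>. \<Sum>v\<in>e. (deg \<Gamma> v)\<^sup>2) = (\<Sum>e\<in>edges \<Gamma>. 2 * (\<Prod>v\<in>e. deg \<Gamma> v))"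
  proof (rule sum.cong[OF HOL.refl])
    fix e assume "e \<in> edges \<Gamma>"
    then obtain u v where "e = {u, v}" "u \<noteq> v" "deg \<Gamma> u = deg \<Gamma> v"
      using E by blast
    thus "(\<Sum>v\<in>e. (deg \<Gamma> v)\<^sup>2) = 2 * (\<Prod>v\<in>e. deg \<Gamma> v)"
      by (simp add: power2_eq_square)
  qed
  thus "2 * zagreb2 \<Gamma> = (\<Sum>v\<in>verts \<Gamma>. deg \<Gamma> v ^ 3)"
    using H[of "\<lambda>v. (deg \<Gamma> v)\<^sup>2"]
    by (simp add: zagreb2_def sum_distrib_left power2_eq_square power3_eq_cube mult.assoc)
qed

text \<open>For nonnegative x and y, (x - y) * (x^2 - y^2) = (x + y) * (x - y)^2 is nonnegative.
  Summing over all ordered pairs from \<open>V\<close> and expanding gives twice the difference of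
  the two sides.\<close>

lemma sum_power_Chebyshev:
  fixes d :: "'v \<Rightarrow> real"
  assumes "finite V" "\<And>v. v \<in> V \<Longrightarrow> d v \<ge> 0"
  shows "(\<Sum>v\<in>V. d v) * (\<Sum>v\<in>V. (d v)\<^sup>2) \<le> real (card V) * (\<Sum>v\<in>V. d v ^ 3)"
proof -
  have "0 \<le> (\<Sum>u\<in>V. \<Sum>v\<in>V. (d u - d v) * ((d u)\<^sup>2 - (d v)\<^sup>2))"
  proof (intro sum_nonneg)
    fix u v assume "u \<in> V" "v \<in> V"
    hence "(d u + d v) * (d u - d v)\<^sup>2 \<ge> 0"
      using assms(2) by simp
    also have "(d u + d v) * (d u - d v)\<^sup>2 = (d u - d v) * ((d u)\<^sup>2 - (d v)\<^sup>2)"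
      by (simp add: power2_eq_square algebra_simps)
    finally show "(d u - d v) * ((d u)\<^sup>2 - (d v)\<^sup>2) \<ge> 0" .
  qed
  also have "\<dots> = (\<Sum>u\<in>V. \<Sum>v\<in>V. d u ^ 3 + d v ^ 3 - d u * (d v)\<^sup>2 - (d u)\<^sup>2 * d v)"
    by (simp add: power2_eq_square power3_eq_cube algebra_simps)
  also have "\<dots> = 2 * (real (card V) * (\<Sum>v\<in>V. d v ^ 3) - (\<Sum>v\<in>V. d v) * (\<Sum>v\<in>V. (d v)\<^sup>2))"
    by (simp add: sum.distrib sum_subtractf sum_distrib_left[symmetric] sum_distrib_right[symmetric])
  finally show ?thesis by simp
qed

text \<open>After cross-multiplication the inequality is \<open>sum_power_Chebyshev\<close> for the
  degrees. If all degrees equal \<open>k\<close> and there is a vertex, both ratios are k^2.\<close>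

lemma zagreb_ratio_regular_components:
  assumes fin: "finite (verts \<Gamma>)"
    and E: "\<And>e. e \<in> edges \<Gamma> \<Longrightarrow> \<exists>u v. e = {u, v} \<and> u \<noteq> v \<and> u \<in> verts \<Gamma> \<and> v \<in> verts \<Gamma> \<and> deg \<Gamma> u = deg \<Gamma> v"
  shows "real (zagreb1 \<Gamma>) / real (card (verts \<Gamma>)) \<le> real (zagreb2 \<Gamma>) / real (card (edges \<Gamma>))"
    and "(\<And>v. v \<in> verts \<Gamma> \<Longrightarrow> deg \<Gamma> v = k) \<Longrightarrow>
      real (zagreb2 \<Gamma>) / real (card (edges \<Gamma>)) = real (zagreb1 \<Gamma>) / real (card (verts \<Gamma>))"
proof -
  note Z = zagreb_regular_components[OF assms]
  have e: "2 * real (card (edges \<Gamma>)) = (\<Sum>v\<in>verts \<Gamma>. real (deg \<Gamma> v))"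
    using arg_cong[OF Z(1), of real] by simp
  have z2: "2 * real (zagreb2 \<Gamma>) = (\<Sum>v\<in>verts \<Gamma>. real (deg \<Gamma> v) ^ 3)"
    using arg_cong[OF Z(2), of real] by simp
  have z1: "real (zagreb1 \<Gamma>) = (\<Sum>v\<in>verts \<Gamma>. (real (deg \<Gamma> v))\<^sup>2)"
    by (simp add: zagreb1_def)
  show "real (zagreb1 \<Gamma>) / real (card (verts \<Gamma>)) \<le> real (zagreb2 \<Gamma>) / real (card (edges \<Gamma>))"
  proof (cases "card (edges \<Gamma>) = 0 \<or> card (verts \<Gamma>) = 0")
    case True
    \<comment> \<open>Without edges all degrees vanish. In both degenerate cases the left quotient
      is 0, since x / 0 = 0.\<close>
    hence "zagreb1 \<Gamma> = 0 \<or> card (verts \<Gamma>) = 0"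
      using Z(1) fin by (auto simp: zagreb1_def)
    thus ?thesis by auto
  next
    case False
    have "real (zagreb1 \<Gamma>) * real (card (edges \<Gamma>)) \<le> real (zagreb2 \<Gamma>) * real (card (verts \<Gamma>))"
      using sum_power_Chebyshev[OF fin, of "\<lambda>v. real (deg \<Gamma> v)"]
      by (simp flip: e z1 z2 add: mult_ac)
    with False show ?thesis
      by (simp add: field_simps)
  qed
  assume k: "\<And>v. v \<in> verts \<Gamma> \<Longrightarrow> deg \<Gamma> v = k"
  show "real (zagreb2 \<Gamma>) / real (card (edges \<Gamma>)) = real (zagreb1 \<Gamma>) / real (card (verts \<Gamma>))"
  proof (cases "k = 0 \<or> card (verts \<Gamma>) = 0")
    case True
    thus ?thesis using e z1 z2 fin by (auto simp: k)
  next
    case False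
    have e': "real (card (edges \<Gamma>)) = real (card (verts \<Gamma>)) * real k / 2"
      using e by (simp add: k)
    have z2': "real (zagreb2 \<Gamma>) = real (card (verts \<Gamma>)) * real k ^ 3 / 2"
      using z2 by (simp add: k)
    have z1': "real (zagreb1 \<Gamma>) = real (card (verts \<Gamma>)) * (real k)\<^sup>2"
      using z1 by (simp add: k)
    show ?thesis unfolding e' z1' z2' using False
      by (simp add: field_simps power2_eq_square power3_eq_cube)
  qed
qed

text \<open>The map \<open>\<kappa>\<close> labels the cliques. An edge at \<open>c x\<close> is
  determined by its other end, which ranges over the clique of \<open>x\<close> without
  \<open>x\<close> itself.\<close>

lemma deg_disjoint_cliques:
  assumes "finite I" and inj: "inj_on c I" and x: "x \<in> I"
    and E: "edges \<Gamma> = {{c x, c y} | x y. x \<in> I \<and> y \<in> I \<and> x \<noteq> y \<and> \<kappa> x = \<kappa> y}"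
  shows "deg \<Gamma> (c x) = card {y \<in> I. \<kappa> y = \<kappa> x} - 1"
proof -
  have "{e \<in> edges \<Gamma>. c x \<in> e} = (\<lambda>y. {c x, c y}) ` ({y \<in> I. \<kappa> y = \<kappa> x} - {x})"
  proof (intro equalityI subsetI)
    fix e assume "e \<in> {e \<in> edges \<Gamma>. c x \<in> e}"
    then obtain u v where uv: "e = {c u, c v}" "u \<in> I" "v \<in> I" "u \<noteq> v" "\<kappa> u = \<kappa> v" "c x = c u \<or> c x = c v"
      unfolding E by auto
    hence "x = u \<or> x = v" using inj x by (auto dest: inj_onD)
    thus "e \<in> (\<lambda>y. {c x, c y}) ` ({y \<in> I. \<kappa> y = \<kappa> x} - {x})"
      using uv by (auto simp: insert_commute)
  next
    fix e assume "e \<in> (\<lambda>y. {c x, c y}) ` ({y \<in> I. \<kappa> y = \<kappa> x} - {x})"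
    then obtain y where "y \<in> I" "\<kappa> y = \<kappa> x" "y \<noteq> x" "e = {c x, c y}" by auto
    thus "e \<in> {e \<in> edges \<Gamma>. c x \<in> e}" unfolding E using x by auto
  qed
  moreover have "inj_on (\<lambda>y. {c x, c y}) ({y \<in> I. \<kappa> y = \<kappa> x} - {x})"
    using inj by (auto simp: inj_on_def doubleton_eq_iff)
  ultimately have "deg \<Gamma> (c x) = card ({y \<in> I. \<kappa> y = \<kappa> x} - {x})"
    by (simp add: deg_def card_image)
  thus ?thesis using x by simp
qed

section \<open>A model of the group on pairs of residues\<close>

text \<open>This is (-1)^k, defined by parity because \<open>k\<close> may be negative. Conjugation
  by a^k raises b to this power.\<close>

definition par_sign :: "int \<Rightarrow> int" where
  "par_sign k = (if even k then 1 else - 1)"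

lemma par_sign_add: "par_sign (i + k) = par_sign i * par_sign k"
  by (auto simp: par_sign_def)

lemma par_sign_square [simp]: "par_sign i * par_sign i = 1" "par_sign i * (par_sign i * x) = x"
  by (auto simp: par_sign_def)

lemma range_par_sign: "range par_sign = {1, - 1}"
proof
  show "{1, - 1} \<subseteq> range par_sign"
    using rangeI[of par_sign 0] rangeI[of par_sign 1] by (simp add: par_sign_def)
qed (auto simp: par_sign_def)

text \<open>Reduction modulo an even number keeps parity, so the action of a on b is well defined on
  exponents modulo 2n.\<close>

lemma par_sign_mod [simp]: "par_sign (i mod (2 * k)) = par_sign i"
  by (simp add: par_sign_def dvd_mod_iff)

lemma mod_mult_mod_add_eq: "(c * (t mod k) + q) mod k = (c * t + q) mod (k::int)"
  by (metis mod_add_left_eq mod_mult_right_eq)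

text \<open>A semidirect product of Z_m by Z_2n, the pair (i, j) standing for a^i b^j. It serves to
  show that the relations identify no more normal forms than the periods 2n and m do.\<close>

definition U_model :: "nat \<Rightarrow> nat \<Rightarrow> (int \<times> int) monoid" where
  "U_model n m =
    \<lparr>carrier = {0..<2 * int n} \<times> {0..<int m},
     monoid.mult = (\<lambda>(i, j) (k, l). ((i + k) mod (2 * int n), (par_sign k * j + l) mod int m)),
     one = (0, 0)\<rparr>"

lemma U_model_mult:
  "(i, j) \<otimes>\<^bsub>U_model n m\<^esub> (k, l) = ((i + k) mod (2 * int n), (par_sign k * j + l) mod int m)"
  by (simp add: U_model_def)

lemma U_model_one: "\<one>\<^bsub>U_model n m\<^esub> = (0, 0)"
  by (simp add: U_model_def)

lemma U_model_carrier: "carrier (U_model n m) = {0..<2 * int n} \<times> {0..<int m}"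
  by (simp add: U_model_def)

lemma U_model_group:
  assumes "n > 0" "m > 0"
  shows "group (U_model n m)"
proof (rule groupI)
  fix x y z
  assume "x \<in> carrier (U_model n m)" "y \<in> carrier (U_model n m)" "z \<in> carrier (U_model n m)"
  obtain i j k l p q where xyz: "x = (i, j)" "y = (k, l)" "z = (p, q)"
    by (cases x, cases y, cases z) auto
  have 1: "(i + k + p) mod (2 * int n) = (i + (k + p)) mod (2 * int n)"
    by (simp add: add.assoc)
  have 2: "(par_sign p * ((par_sign k * j + l) mod int m) + q) mod int m
      = (par_sign (k + p) * j + (par_sign p * l + q) mod int m) mod int m"
    by (simp add: mod_mult_mod_add_eq mod_add_right_eq par_sign_add distrib_left add.assoc mult_ac)
  show "x \<otimes>\<^bsub>U_model n m\<^esub> y \<otimes>\<^bsub>U_model n m\<^esub> z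
      = x \<otimes>\<^bsub>U_model n m\<^esub> (y \<otimes>\<^bsub>U_model n m\<^esub> z)"
    unfolding xyz U_model_mult par_sign_mod using 1 2 by (simp add: mod_simps)
next
  fix x assume x: "x \<in> carrier (U_model n m)"
  obtain i j where ij: "x = (i, j)" by (cases x)
  \<comment> \<open>The inverse of a^i b^j is b^(-j) a^(-i) = a^(-i) b^(-s j), where s is the sign
    of i.\<close>
  define y where "y = ((- i) mod (2 * int n), (- par_sign i * j) mod int m)"
  have "y \<in> carrier (U_model n m)"
    using assms by (simp add: y_def U_model_carrier)
  moreover have "y \<otimes>\<^bsub>U_model n m\<^esub> x = \<one>\<^bsub>U_model n m\<^esub>"
    unfolding y_def ij U_model_mult U_model_one by (simp add: mod_mult_mod_add_eq mod_add_left_eq)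
  ultimately show "\<exists>y\<in>carrier (U_model n m). y \<otimes>\<^bsub>U_model n m\<^esub> x = \<one>\<^bsub>U_model n m\<^esub>"
    by blast
qed (use assms in \<open>auto simp: U_model_def\<close>)

text \<open>The inductions run up and down from 0; the downward steps use the explicit inverses of
  the generators. Writing \<open>1 mod int m\<close> instead of 1 covers m = 1.\<close>

lemma U_model_int_pow:
  assumes "n > 0" "m > 0"
  shows "(1 mod (2 * int n), 0) [^]\<^bsub>U_model n m\<^esub> (i::int) = (i mod (2 * int n), 0)" (is "?a [^]\<^bsub>_\<^esub> i = _")
    and "(0, 1 mod int m) [^]\<^bsub>U_model n m\<^esub> (i::int) = (0, i mod int m)" (is "?b [^]\<^bsub>_\<^esub> i = _")
proof -
  interpret group "U_model n m" using assms by (rule U_model_group)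
  have a: "?a \<in> carrier (U_model n m)" and b: "?b \<in> carrier (U_model n m)"
    using assms by (auto simp: U_model_carrier)
  have a': "inv\<^bsub>U_model n m\<^esub> ?a = (- 1 mod (2 * int n), 0)"
    by (rule inv_equality) (use assms a in \<open>auto simp: U_model_carrier U_model_mult U_model_one mod_simps\<close>)
  have b': "inv\<^bsub>U_model n m\<^esub> ?b = (0, - 1 mod int m)"
    by (rule inv_equality) (use assms b in \<open>auto simp: U_model_carrier U_model_mult U_model_one mod_simps par_sign_def\<close>)
  show "?a [^]\<^bsub>U_model n m\<^esub> i = (i mod (2 * int n), 0)"
  proof (induction i rule: int_induct[where k = 0])
    case (step1 i)
    then show ?case using a int_pow_mult[OF a, of i 1]
      by (simp add: U_model_mult mod_simps)
  next
    case (step2 i)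
    then show ?case using a a' int_pow_mult[OF a, of i "-1"] int_pow_neg[OF a, of 1]
      by (simp add: U_model_mult mod_simps)
  qed (simp add: U_model_one)
  show "?b [^]\<^bsub>U_model n m\<^esub> i = (0, i mod int m)"
  proof (induction i rule: int_induct[where k = 0])
    case (step1 i)
    then show ?case using b int_pow_mult[OF b, of i 1]
      by (simp add: U_model_mult mod_simps par_sign_def)
  next
    case (step2 i)
    then show ?case using b b' int_pow_mult[OF b, of i "-1"] int_pow_neg[OF b, of 1]
      by (simp add: U_model_mult mod_simps par_sign_def)
  qed (simp add: U_model_one)
qed

text \<open>Conjugation by a inverts b, so each factor a or its inverse that moves left past a power
  of b flips the sign of the exponent.\<close>

lemma (in group) inverting_int_pow_commute:
  assumes a: "a \<in> carrier G" and b: "b \<in> carrier G" and rel: "inv a \<otimes> b \<otimes> a = inv b"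
  shows "b [^] (j::int) \<otimes> a [^] (i::int) = a [^] i \<otimes> b [^] (par_sign i * j)"
proof -
  have ba: "b \<otimes> a = a \<otimes> inv b"
    using rel a b by (metis inv_closed inv_solve_left m_assoc m_closed)
  have b'a: "inv b \<otimes> a = a \<otimes> b"
    using ba a b by (metis inv_closed inv_inv inv_solve_left inv_solve_right m_assoc m_closed)
  have step: "b [^] (j::int) \<otimes> a = a \<otimes> b [^] (- j)" for j
  proof (induction j rule: int_induct[where k = 0])
    case (step1 j)
    have "b [^] (j + 1) \<otimes> a = b [^] j \<otimes> (b \<otimes> a)"
      using a b by (simp add: int_pow_mult m_assoc)
    also have "\<dots> = a \<otimes> b [^] (- j) \<otimes> inv b"
      using a b step1 by (simp add: ba m_assoc[symmetric])
    also have "\<dots> = a \<otimes> b [^] (- (j + 1))"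
      using a b int_pow_mult[OF b, of "- j" "- 1"] int_pow_neg[OF b, of 1] by (simp add: m_assoc)
    finally show ?case .
  next
    case (step2 j)
    have "b [^] (j - 1) \<otimes> a = b [^] j \<otimes> (inv b \<otimes> a)"
      using a b int_pow_mult[OF b, of j "- 1"] int_pow_neg[OF b, of 1] by (simp add: m_assoc)
    also have "\<dots> = a \<otimes> b [^] (- j) \<otimes> b"
      using a b step2 by (simp add: b'a m_assoc[symmetric])
    also have "\<dots> = a \<otimes> b [^] (- (j - 1))"
      using a b int_pow_mult[OF b, of "- j" "1"] by (simp add: m_assoc)
    finally show ?case .
  qed (use a b in simp)
  \<comment> \<open>This is \<open>step\<close> for \<open>- j\<close>, multiplied by the inverse of
    a on both sides.\<close>
  have step': "b [^] (j::int) \<otimes> inv a = inv a \<otimes> b [^] (- j)" for j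
  proof -
    have "b [^] j = inv a \<otimes> (b [^] (- j) \<otimes> a)"
      using step[of "- j"] a b by (simp add: inv_solve_left)
    thus ?thesis
      using a b by (simp add: m_assoc)
  qed
  show ?thesis
  proof (induction i rule: int_induct[where k = 0])
    case (step1 i)
    have "b [^] j \<otimes> a [^] (i + 1) = a [^] i \<otimes> (b [^] (par_sign i * j) \<otimes> a)"
      using a b step1 by (simp add: int_pow_mult m_assoc[symmetric])
    also have "\<dots> = a [^] (i + 1) \<otimes> b [^] (par_sign (i + 1) * j)"
      using a b by (simp add: int_pow_mult m_assoc step par_sign_def)
    finally show ?case .
  next
    case (step2 i)
    have e: "a [^] (i - 1) = a [^] i \<otimes> inv a"
      using a int_pow_mult[OF a, of i "- 1"] int_pow_neg[OF a, of 1] by simp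
    have "b [^] j \<otimes> a [^] (i - 1) = a [^] i \<otimes> (b [^] (par_sign i * j) \<otimes> inv a)"
      using a b step2 by (simp add: e m_assoc[symmetric])
    also have "\<dots> = a [^] (i - 1) \<otimes> b [^] (par_sign (i - 1) * j)"
      using a b by (simp add: e m_assoc step' par_sign_def)
    finally show ?case .
  qed (use a b in \<open>simp add: par_sign_def\<close>)
qed

section \<open>The commuting conjugacy class graph\<close>

lemma int_dvd_diff_small_iff:
  fixes i k N :: int
  assumes "0 \<le> i" "i < N" "0 \<le> k" "k < N"
  shows "N dvd i - k \<longleftrightarrow> i = k"
  using assms by (metis mod_eq_dvd_iff mod_pos_pos_trivial)

text \<open>Coordinates a^i b^j with arbitrary integer exponents: products need no reduction, and
  the periods enter only through \<open>phi_eq_iff\<close>. The graph is computed from these rules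
  alone, without reference to words.\<close>

locale U_param = group G for G (structure) +
  fixes \<phi> :: "int \<Rightarrow> int \<Rightarrow> 'a" and n m :: nat
  assumes carrier_iff: "x \<in> carrier G \<longleftrightarrow> (\<exists>i j. x = \<phi> i j)"
    and phi_mult: "\<phi> i j \<otimes> \<phi> k l = \<phi> (i + k) (par_sign k * j + l)"
    and phi_eq_iff: "\<phi> i j = \<phi> k l \<longleftrightarrow> 2 * int n dvd i - k \<and> int m dvd j - l"
    and n_pos: "n > 0" and m_ge: "m \<ge> 3"
begin

section \<open>Commutation, conjugacy and the center in coordinates\<close>

lemma phi_closed [simp]: "\<phi> i j \<in> carrier G"
  using carrier_iff by blast

text \<open>Both products have the same exponent of a, so only the exponents of b have to agree
  modulo m.\<close>

lemma phi_commute: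
  "\<phi> i j \<otimes> \<phi> k l = \<phi> k l \<otimes> \<phi> i j \<longleftrightarrow>
    int m dvd (par_sign k - 1) * j - (par_sign i - 1) * l"
  by (simp add: phi_mult phi_eq_iff algebra_simps)

text \<open>Conjugation keeps the exponent of a. For odd \<open>i\<close> it shifts \<open>j\<close>
  by -2l before the sign of \<open>k\<close> acts; for even \<open>i\<close> only the sign
  acts.\<close>

lemma phi_conj: "\<phi> k l \<otimes> \<phi> i j \<otimes> inv \<phi> k l = \<phi> i (par_sign k * ((par_sign i - 1) * l + j))"
proof -
  have "\<phi> k l \<otimes> \<phi> i j = \<phi> i (par_sign k * ((par_sign i - 1) * l + j)) \<otimes> \<phi> k l"
    by (simp add: phi_mult add.commute left_diff_distrib mult.assoc[symmetric])
  thus ?thesis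
    by (metis inv_solve_right m_closed phi_closed)
qed

lemma class_eq: "conj_class G (\<phi> i j) = {\<phi> i (par_sign k * ((par_sign i - 1) * l + j)) | k l. True}"
proof -
  have "conj_class G (\<phi> i j) = {\<phi> k l \<otimes> \<phi> i j \<otimes> inv \<phi> k l | k l. True}"
    unfolding conj_class_def carrier_iff by blast
  thus ?thesis by (simp only: phi_conj)
qed

lemma class_even:
  assumes "even i"
  shows "conj_class G (\<phi> i j) = {\<phi> i j, \<phi> i (- j)}"
proof -
  have "conj_class G (\<phi> i j) = range (\<lambda>k. \<phi> i (par_sign k * j))"
    using assms by (auto simp: class_eq par_sign_def)
  also have "\<dots> = {\<phi> i j, \<phi> i (- j)}"
  proof -
    have "range (\<lambda>k. \<phi> i (par_sign k * j)) = (\<lambda>s. \<phi> i (s * j)) ` range par_sign"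
      by blast
    thus ?thesis by (simp add: range_par_sign)
  qed
  finally show ?thesis .
qed

text \<open>Shifts by even numbers absorb the sign, as -j = j - 2j. Here \<open>l\<close> is an
  integer, not a residue: for odd m the exponents l and l + m have different parity, so the set then
  contains every a^i b^l.\<close>

lemma class_odd:
  assumes "odd i"
  shows "conj_class G (\<phi> i j) = {\<phi> i l | l. even (l - j)}"
proof (intro equalityI subsetI)
  fix x assume "x \<in> conj_class G (\<phi> i j)"
  thus "x \<in> {\<phi> i l | l. even (l - j)}"
    using assms by (fastforce simp: class_eq par_sign_def)
next
  fix x assume "x \<in> {\<phi> i l | l. even (l - j)}"
  then obtain l where "x = \<phi> i l" "even (l - j)" by blast
  hence "x = \<phi> i (j + 2 * ((l - j) div 2))" by simp
  then obtain t where t: "x = \<phi> i (j + 2 * t)" ..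
  \<comment> \<open>The witness \<open>- t\<close> produces the shift (-2) * (-t) = 2t.\<close>
  have "x = \<phi> i (par_sign 0 * ((par_sign i - 1) * (- t) + j))"
    using assms t by (simp add: par_sign_def add.commute)
  thus "x \<in> conj_class G (\<phi> i j)"
    unfolding class_eq by blast
qed

lemma phi_central_iff: "\<phi> i j \<in> group_center G \<longleftrightarrow> even i \<and> int m dvd 2 * j"
proof -
  have "\<phi> i j \<in> group_center G \<longleftrightarrow> (\<forall>g\<in>carrier G. \<phi> i j \<otimes> g = g \<otimes> \<phi> i j)"
    by (simp add: group_center_def)
  also have "\<dots> \<longleftrightarrow> (\<forall>k l. int m dvd (par_sign k - 1) * j - (par_sign i - 1) * l)"
    unfolding phi_commute[symmetric] by (metis carrier_iff)
  also have "\<dots> \<longleftrightarrow> even i \<and> int m dvd 2 * j"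
  proof (intro iffI conjI allI)
    assume *: "\<forall>k l. int m dvd (par_sign k - 1) * j - (par_sign i - 1) * l"
    \<comment> \<open>The test elements are b and a: for odd \<open>i\<close>, commuting with b
      would force m to divide 2, and commuting with a gives the condition on
      \<open>j\<close>.\<close>
    show "even i"
    proof (rule ccontr)
      assume "odd i"
      with spec[OF spec[OF *, of 0], of 1] have "int m dvd 2" by (simp add: par_sign_def)
      thus False using m_ge zdvd_imp_le by fastforce
    qed
    show "int m dvd 2 * j"
      using spec[OF spec[OF *, of 1], of 0] by (simp add: par_sign_def)
  qed (auto simp: par_sign_def)
  finally show ?thesis .
qed

section \<open>Representatives of the noncentral classes\<close>

text \<open>One index $(i, j)$ for each class of a noncentral $a^i b^j$.\<close>

definition idx_even :: "(int \<times> int) set" where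
  "idx_even = (\<lambda>i. 2 * i) ` {0..<int n} \<times> {1..(int m - 1) div 2}"

text \<open>For even m the parity of \<open>j\<close> distinguishes two classes for each odd
  exponent of a; for odd m there is only one.\<close>

definition idx_odd :: "(int \<times> int) set" where
  "idx_odd = (\<lambda>i. 2 * i + 1) ` {0..<int n} \<times> {0..<(if odd m then 1 else 2)}"

definition idx :: "(int \<times> int) set" where
  "idx = idx_even \<union> idx_odd"

lemma idx_iff:
  "(i, j) \<in> idx \<longleftrightarrow> 0 \<le> i \<and> i < 2 * int n \<and>
    (if even i then 1 \<le> j \<and> j \<le> (int m - 1) div 2 else 0 \<le> j \<and> j < (if odd m then 1 else 2))"
proof -
  have "i \<in> (\<lambda>i. 2 * i) ` {0..<int n} \<longleftrightarrow> even i \<and> 0 \<le> i \<and> i < 2 * int n"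
    by (auto elim!: evenE)
  moreover have "i \<in> (\<lambda>i. 2 * i + 1) ` {0..<int n} \<longleftrightarrow> odd i \<and> 0 \<le> i \<and> i < 2 * int n"
    by (auto elim!: oddE)
  ultimately show ?thesis
    unfolding idx_def idx_even_def idx_odd_def by auto
qed

definition cls :: "int \<times> int \<Rightarrow> 'a set" where
  "cls = (\<lambda>(i, j). conj_class G (\<phi> i j))"

lemma phi_in_class: "\<phi> i j \<in> conj_class G (\<phi> i j)"
  by (cases "even i") (auto simp: class_even class_odd)

lemma inj_cls: "inj_on cls idx"
proof (rule inj_onI)
  fix x y assume xy: "x \<in> idx" "y \<in> idx" "cls x = cls y"
  obtain i j k l where ij: "x = (i, j)" "y = (k, l)" by (cases x, cases y) auto
  note I = xy(1,2)[unfolded ij idx_iff]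
  have mem: "\<phi> i j \<in> conj_class G (\<phi> k l)"
    using xy(3) phi_in_class[of i j] by (simp add: cls_def ij)
  hence "2 * int n dvd i - k"
    by (auto simp: class_eq phi_eq_iff)
  hence ik: "i = k" using I by (simp add: int_dvd_diff_small_iff)
  have "j = l"
  proof (cases "even i")
    case True
    with mem ik have "int m dvd j - l \<or> int m dvd j + l"
      by (auto simp: class_even phi_eq_iff)
    \<comment> \<open>Both representatives are at most (m - 1) div 2, so 0 < j + l < m.\<close>
    moreover have "\<not> int m dvd j + l"
      using True I ik by (auto dest!: zdvd_imp_le)
    moreover have "0 \<le> j" "j < int m" "0 \<le> l" "l < int m"
      using True I ik by auto
    ultimately show ?thesis
      using int_dvd_diff_small_iff by blast
  next
    case False
    then obtain t where "int m dvd j - t" "even (t - l)"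
      using mem ik by (auto simp: class_odd phi_eq_iff)
    \<comment> \<open>For even m, congruence modulo m preserves parity, so parity of the exponent of
      b is a class invariant.\<close>
    hence "even m \<Longrightarrow> even (j - l)"
      by (metis dvd_trans even_diff even_add even_of_nat)
    moreover have "0 \<le> j" "0 \<le> l" "j < 2" "l < 2" "odd m \<Longrightarrow> j = 0 \<and> l = 0"
      using I ik False by (auto split: if_splits)
    ultimately show ?thesis by presburger
  qed
  with ik ij show "x = y" by simp
qed

lemma finite_idx: "finite idx_even" "finite idx_odd" "finite idx"
  by (auto simp: idx_def idx_even_def idx_odd_def)

lemma idx_noncentral:
  assumes "(i, j) \<in> idx"
  shows "\<phi> i j \<notin> group_center G"
proof -
  \<comment> \<open>The range of \<open>j\<close> is chosen such that 0 < 2j < m.\<close>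
  have "\<not> int m dvd 2 * j" if "even i"
    using assms that by (auto simp: idx_iff dest!: zdvd_imp_le)
  thus ?thesis by (auto simp: phi_central_iff)
qed

text \<open>The exponents are reduced modulo their periods. For even \<open>i\<close>, noncentrality
  excludes the residues 0 and m/2, and replacing l by m - l brings the rest below m/2.\<close>

lemma noncentral_class:
  assumes nc: "\<phi> i j \<notin> group_center G"
  shows "\<exists>x\<in>idx. conj_class G (\<phi> i j) = cls x"
proof -
  define k where "k = i mod (2 * int n)"
  have k: "0 \<le> k" "k < 2 * int n" "2 * int n dvd i - k" "even k \<longleftrightarrow> even i"
    using n_pos by (auto simp: k_def dvd_mod_iff mod_eq_dvd_iff[symmetric])
  show ?thesis
  proof (cases "even i")
    case True
    define l where "l = j mod int m"
    have l: "0 \<le> l" "l < int m" "int m dvd j - l"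
      using m_ge by (auto simp: l_def mod_eq_dvd_iff[symmetric])
    have phi: "\<phi> i j = \<phi> k l" using k l by (simp add: phi_eq_iff)
    have "\<not> int m dvd 2 * l"
      using nc k True by (simp add: phi phi_central_iff)
    hence ne: "l \<noteq> 0" "2 * l \<noteq> int m" by auto
    show ?thesis
    proof (cases "2 * l < int m")
      case True
      hence "(k, l) \<in> idx" using k l ne \<open>even i\<close> by (auto simp: idx_iff)
      thus ?thesis by (rule bexI[rotated]) (simp add: phi cls_def)
    next
      case False
      have "(k, int m - l) \<in> idx" using False k l ne \<open>even i\<close> by (auto simp: idx_iff)
      moreover have "\<phi> k l = \<phi> k (- (int m - l))" "\<phi> k (- l) = \<phi> k (int m - l)"
        by (simp_all add: phi_eq_iff)
      hence "conj_class G (\<phi> i j) = cls (k, int m - l)"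
        using k True by (auto simp: phi cls_def class_even)
      ultimately show ?thesis by blast
    qed
  next
    case False
    define l where "l = (if odd m then 0 else j mod 2)"
    \<comment> \<open>For odd m, adding m to an odd exponent makes it even without changing the
      element. Hence \<open>j'\<close> always has the parity of \<open>l\<close>.\<close>
    define j' where "j' = (if odd m \<and> odd j then j + int m else j)"
    have "\<phi> i j = \<phi> k j'" using k by (simp add: phi_eq_iff j'_def)
    moreover have "even (t - j') \<longleftrightarrow> even (t - l)" for t
      by (auto simp: j'_def l_def)
    ultimately have "conj_class G (\<phi> i j) = cls (k, l)"
      using k False by (simp add: cls_def class_odd)
    moreover have "(k, l) \<in> idx"
      using k False by (auto simp: idx_iff l_def)
    ultimately show ?thesis by blast
  qed
qed

lemma verts_ccc: "verts (ccc_graph G) = cls ` idx"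
proof (intro equalityI subsetI)
  fix X assume "X \<in> verts (ccc_graph G)"
  then obtain i j where "X = conj_class G (\<phi> i j)" "\<phi> i j \<notin> group_center G"
    by (auto simp: ccc_graph_def Let_def carrier_iff)
  thus "X \<in> cls ` idx" using noncentral_class by blast
next
  fix X assume "X \<in> cls ` idx"
  then obtain i j where "X = conj_class G (\<phi> i j)" "(i, j) \<in> idx"
    by (auto simp: cls_def)
  thus "X \<in> verts (ccc_graph G)"
    using idx_noncentral by (auto simp: ccc_graph_def Let_def)
qed

section \<open>Adjacency of classes\<close>

definition component :: "int \<times> int \<Rightarrow> bool \<times> int" where
  "component = (\<lambda>(i, j). (odd i, if odd i \<and> 4 dvd m then j else 0))"

text \<open>For two odd exponents of a, the b-exponents may be changed by even amounts until m
  divides twice their difference. If 4 divides m, this requires equal parity; otherwise it can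
  always be achieved.\<close>

lemma cls_commute_iff:
  assumes "x \<in> idx" "y \<in> idx"
  shows "(\<exists>u\<in>cls x. \<exists>v\<in>cls y. u \<otimes> v = v \<otimes> u) \<longleftrightarrow> component x = component y" (is "?C x y \<longleftrightarrow> _")
proof -
  \<comment> \<open>Commuting would make m divide 2j, so the representative with even exponent of a
    would be central.\<close>
  have mixed: "\<not> ?C (i, j) (k, l)" if ik: "even i" "odd k" and ij: "(i, j) \<in> idx" for i j k l
  proof
    assume "?C (i, j) (k, l)"
    then obtain j' l' where "\<phi> i j' \<otimes> \<phi> k l' = \<phi> k l' \<otimes> \<phi> i j'" "j' = j \<or> j' = - j"
      using ik by (auto simp: cls_def class_even class_odd)
    hence "int m dvd 2 * j"
      using ik by (auto simp: phi_commute par_sign_def)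
    thus False
      using ik idx_noncentral[OF ij] by (simp add: phi_central_iff)
  qed
  have mixed': "\<not> ?C (k, l) (i, j)" if "even i" "odd k" "(i, j) \<in> idx" for i j k l
    using mixed[OF that] by metis
  obtain i j k l where ij: "x = (i, j)" "y = (k, l)" by (cases x, cases y) auto
  note I = assms[unfolded ij idx_iff]
  consider "even i" "even k" | "even i" "odd k" | "odd i" "even k" | "odd i" "odd k" by blast
  thus ?thesis
  proof cases
    case 1
    have "\<phi> i j \<otimes> \<phi> k l = \<phi> k l \<otimes> \<phi> i j" using 1 by (simp add: phi_commute par_sign_def)
    hence "?C x y" using phi_in_class by (auto simp: ij cls_def)
    thus ?thesis using 1 by (simp add: component_def ij)
  next
    case 2
    hence "component x \<noteq> component y" by (simp add: component_def ij)
    thus ?thesis using mixed[OF 2] assms unfolding ij by blast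
  next
    case 3
    hence "component x \<noteq> component y" by (simp add: component_def ij)
    thus ?thesis using mixed'[OF 3(2,1)] assms unfolding ij by blast
  next
    case 4
    have comm: "\<phi> i j' \<otimes> \<phi> k l' = \<phi> k l' \<otimes> \<phi> i j' \<longleftrightarrow> int m dvd 2 * (l' - j')" for j' l'
    proof -
      have "(par_sign k - 1) * j' - (par_sign i - 1) * l' = 2 * (l' - j')"
        using 4 by (simp add: par_sign_def)
      thus ?thesis by (simp only: phi_commute)
    qed
    have C': "cls x = {\<phi> i j' | j'. even (j' - j)}" "cls y = {\<phi> k l' | l'. even (l' - l)}"
      using 4 by (simp_all add: ij cls_def class_odd)
    have C: "?C x y \<longleftrightarrow> (\<exists>j' l'. even (j' - j) \<and> even (l' - l) \<and> int m dvd 2 * (l' - j'))"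
      unfolding C' comm[symmetric] by blast
    show ?thesis
    proof (cases "4 dvd m")
      case True
      hence m4: "4 dvd int m" by presburger
      have "?C x y \<longleftrightarrow> even (j - l)"
      proof
        assume "?C x y"
        then obtain j' l' where "even (j' - j)" "even (l' - l)" "int m dvd 2 * (l' - j')"
          using C by blast
        \<comment> \<open>Here 4 divides 2 * (l' - j'), so l' - j' is even.\<close>
        from dvd_trans[OF m4 this(3)] have "even (l' - j')" by presburger
        with \<open>even (j' - j)\<close> \<open>even (l' - l)\<close> show "even (j - l)" by presburger
      next
        assume "even (j - l)"
        thus "?C x y" unfolding C by (intro exI[of _ l]) simp
      qed
      also have "\<dots> \<longleftrightarrow> j = l"
      proof -
        have "0 \<le> j" "0 \<le> l" "j < 2" "l < 2"
          using I \<open>odd i\<close> \<open>odd k\<close> by (auto split: if_splits)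
        thus ?thesis by presburger
      qed
      finally show ?thesis using True \<open>odd i\<close> \<open>odd k\<close> by (simp add: component_def ij)
    next
      case False
      have "\<exists>j'. even (j' - j) \<and> int m dvd 2 * (l - j')"
      proof (cases "even (l - j)")
        case True
        thus ?thesis by (intro exI[of _ l]) simp
      next
        case odd: False
        have "j = 0 \<and> l = 0" if "odd m"
          using I that \<open>odd i\<close> \<open>odd k\<close> by auto
        with odd have "even m" by auto
        then obtain h where h: "m = 2 * h" by blast
        hence "odd h" using False by presburger
        \<comment> \<open>With m = 2h and h odd, l - h has the parity of j, and 2 * (l - (l - h)) =
          m.\<close>
        thus ?thesis using odd h by (intro exI[of _ "l - int h"]) auto
      qed
      hence "?C x y" unfolding C by (metis diff_self dvd_0_right)
      thus ?thesis using False 4 by (simp add: component_def ij)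
    qed
  qed
qed

lemma edges_ccc:
  "edges (ccc_graph G) = {{cls x, cls y} | x y. x \<in> idx \<and> y \<in> idx \<and> x \<noteq> y \<and> component x = component y}"
proof -
  have V: "conj_class G ` (carrier G - group_center G) = cls ` idx"
    using verts_ccc by (simp add: ccc_graph_def Let_def)
  have "edges (ccc_graph G) = {{X, Y} | X Y. X \<in> cls ` idx \<and> Y \<in> cls ` idx \<and> X \<noteq> Y \<and>
      (\<exists>u\<in>X. \<exists>v\<in>Y. u \<otimes> v = v \<otimes> u)}"
    by (simp add: ccc_graph_def Let_def V)
  also have "\<dots> = {{cls x, cls y} | x y. x \<in> idx \<and> y \<in> idx \<and> cls x \<noteq> cls y \<and>
      (\<exists>u\<in>cls x. \<exists>v\<in>cls y. u \<otimes> v = v \<otimes> u)}"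
    by blast
  also have "\<dots> = {{cls x, cls y} | x y. x \<in> idx \<and> y \<in> idx \<and> x \<noteq> y \<and> component x = component y}"
  proof -
    have "x \<in> idx \<and> y \<in> idx \<and> cls x \<noteq> cls y \<and> (\<exists>u\<in>cls x. \<exists>v\<in>cls y. u \<otimes> v = v \<otimes> u) \<longleftrightarrow>
        x \<in> idx \<and> y \<in> idx \<and> x \<noteq> y \<and> component x = component y" for x y
      using cls_commute_iff[of x y] inj_on_eq_iff[OF inj_cls, of x y] by argo
    thus ?thesis by (simp only:)
  qed
  finally show ?thesis .
qed

section \<open>Clique sizes and degrees\<close>

text \<open>The cliques with odd exponent of a have size 2n if m is 2 modulo 4, where two classes
  per exponent lie in one clique. They have size n if m is odd (one class per exponent) or divisible
  by 4 (two cliques).\<close>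

definition odd_deg :: nat where
  "odd_deg = (if even m \<and> \<not> 4 dvd m then 2 * n - 1 else n - 1)"

lemma card_idx_even: "card idx_even = n * ((m - 1) div 2)"
proof -
  have "nat ((int m - 1) div 2) = (m - 1) div 2"
    using m_ge by (simp add: nat_div_distrib nat_diff_distrib)
  thus ?thesis
    by (simp add: idx_even_def card_cartesian_product card_image inj_on_def)
qed

lemma card_idx_odd: "card idx_odd = (if odd m then n else 2 * n)"
  by (simp add: idx_odd_def card_cartesian_product card_image inj_on_def)

lemma idx_even_parity: "x \<in> idx_even \<Longrightarrow> even (fst x)"
  and idx_odd_parity: "x \<in> idx_odd \<Longrightarrow> odd (fst x)"
  by (auto simp: idx_even_def idx_odd_def)

lemma component_eq_iff:
  "component x = component y \<longleftrightarrow>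
    (even (fst x) \<longleftrightarrow> even (fst y)) \<and> (odd (fst x) \<and> 4 dvd m \<longrightarrow> snd x = snd y)"
  by (cases x; cases y) (simp add: component_def)

lemma deg_cls_eq: "x \<in> idx \<Longrightarrow> deg (ccc_graph G) (cls x) = card {y \<in> idx. component y = component x} - 1"
  by (rule deg_disjoint_cliques[OF finite_idx(3) inj_cls _ edges_ccc])

lemma deg_cls_even:
  assumes "x \<in> idx_even"
  shows "deg (ccc_graph G) (cls x) = n * ((m - 1) div 2) - 1"
proof -
  have x: "x \<in> idx" using assms by (simp add: idx_def)
  have "y \<in> idx \<and> component y = component x \<longleftrightarrow> y \<in> idx_even" for y
    using idx_even_parity[of y] idx_odd_parity[of y] idx_even_parity[OF assms]
    by (auto simp: idx_def component_eq_iff)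
  hence "{y \<in> idx. component y = component x} = idx_even" by simp
  thus ?thesis by (simp only: deg_cls_eq[OF x] card_idx_even)
qed

lemma deg_cls_odd:
  assumes "x \<in> idx_odd"
  shows "deg (ccc_graph G) (cls x) = odd_deg"
proof -
  have idx: "x \<in> idx" using assms by (simp add: idx_def)
  show ?thesis
  proof (cases "4 dvd m")
    case False
    have "y \<in> idx \<and> component y = component x \<longleftrightarrow> y \<in> idx_odd" for y
      using idx_even_parity[of y] idx_odd_parity[of y] idx_odd_parity[OF assms] False
      by (auto simp: idx_def component_eq_iff)
    hence "{y \<in> idx. component y = component x} = idx_odd" by simp
    thus ?thesis using False deg_cls_eq[OF idx] by (auto simp: card_idx_odd odd_deg_def)
  next
    case True
    obtain i j where x: "x = (i, j)" by (cases x)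
    have "y \<in> idx \<and> component y = component x \<longleftrightarrow> y \<in> idx_odd \<and> snd y = j" for y
      using idx_even_parity[of y] idx_odd_parity[of y] idx_odd_parity[OF assms] True
      by (auto simp: idx_def component_eq_iff x)
    hence "{y \<in> idx. component y = component x} = {y \<in> idx_odd. snd y = j}" by simp
    \<comment> \<open>If 4 divides m, the clique fixes \<open>j\<close> and contains one class for
      each of the n odd exponents of a.\<close>
    also have "\<dots> = (\<lambda>i. 2 * i + 1) ` {0..<int n} \<times> {j}"
      using assms by (auto simp: x idx_odd_def)
    finally have comps: "{y \<in> idx. component y = component x} = (\<lambda>i. 2 * i + 1) ` {0..<int n} \<times> {j}" .
    have "card {y \<in> idx. component y = component x} = n"
      unfolding comps by (simp add: card_cartesian_product card_image inj_on_def)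
    thus ?thesis using True deg_cls_eq[OF idx] by (simp add: odd_deg_def)
  qed
qed

text \<open>The degree takes one value on each of the two kinds of vertices. Taking squares and
  cubes for \<open>f\<close> gives the sums needed for the two indices.\<close>

lemma sum_verts_ccc:
  "(\<Sum>v\<in>verts (ccc_graph G). f (deg (ccc_graph G) v)) =
    n * ((m - 1) div 2) * f (n * ((m - 1) div 2) - 1) + (if odd m then n else 2 * n) * f odd_deg"
proof -
  have "(\<Sum>v\<in>verts (ccc_graph G). f (deg (ccc_graph G) v)) = (\<Sum>x\<in>idx. f (deg (ccc_graph G) (cls x)))"
    unfolding verts_ccc by (subst sum.reindex[OF inj_cls]) (simp add: o_def)
  also have "\<dots> = (\<Sum>x\<in>idx_even. f (deg (ccc_graph G) (cls x))) + (\<Sum>x\<in>idx_odd. f (deg (ccc_graph G) (cls x)))"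
    unfolding idx_def
  proof (rule sum.union_disjoint[OF finite_idx(1,2)])
    show "idx_even \<inter> idx_odd = {}"
      using idx_even_parity idx_odd_parity by (meson disjoint_iff)
  qed
  finally show ?thesis
    by (simp add: deg_cls_even deg_cls_odd card_idx_even card_idx_odd)
qed

lemma finite_verts_ccc: "finite (verts (ccc_graph G))"
  by (simp add: verts_ccc finite_idx)

text \<open>Adjacent classes lie in one clique. This is the hypothesis under which the general
  results on Zagreb indices apply.\<close>

lemma edges_ccc_equal_deg:
  assumes "e \<in> edges (ccc_graph G)"
  shows "\<exists>u v. e = {u, v} \<and> u \<noteq> v \<and> u \<in> verts (ccc_graph G) \<and> v \<in> verts (ccc_graph G) \<and>
    deg (ccc_graph G) u = deg (ccc_graph G) v"
proof -
  obtain x y where xy: "e = {cls x, cls y}" "x \<in> idx" "y \<in> idx" "x \<noteq> y" "component x = component y"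
    using assms unfolding edges_ccc by blast
  have "deg (ccc_graph G) (cls x) = deg (ccc_graph G) (cls y)"
    using xy by (simp add: deg_cls_eq)
  moreover have "cls x \<noteq> cls y"
    using xy inj_on_eq_iff[OF inj_cls] by blast
  ultimately show ?thesis
    using xy verts_ccc by blast
qed

end

section \<open>Normal forms in the presented group\<close>

context
  fixes n m :: nat
begin

abbreviation "Ua \<equiv> word_class (U_relations n m) [Pos gen_a]"
abbreviation "Ub \<equiv> word_class (U_relations n m) [Pos gen_b]"

lemma U_one: "\<one>\<^bsub>U_group n m\<^esub> = word_class (U_relations n m) []"
  by (simp add: U_group_def presented_group_def)

lemma U_mult: "word_class (U_relations n m) u \<otimes>\<^bsub>U_group n m\<^esub> word_class (U_relations n m) v =
    word_class (U_relations n m) (u @ v)"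
  by (simp add: U_group_def presented_group_mult)

lemma U_carrier: "x \<in> carrier (U_group n m) \<longleftrightarrow> (\<exists>u. x = word_class (U_relations n m) u)"
  by (auto simp: U_group_def presented_group_def)

interpretation U: group "U_group n m"
  unfolding U_group_def by (rule presented_group_is_group)

lemma U_word_closed: "word_class (U_relations n m) u \<in> carrier (U_group n m)"
  using U_carrier by blast

lemma U_pow: "word_class (U_relations n m) [l] [^]\<^bsub>U_group n m\<^esub> (k::nat) =
    word_class (U_relations n m) (replicate k l)"
  by (induction k) (simp_all add: U_one U_mult replicate_append_same)

lemma U_inv: "inv\<^bsub>U_group n m\<^esub> (word_class (U_relations n m) [l]) = word_class (U_relations n m) [inv_letter l]"
proof (rule U.inv_equality)
  show "word_class (U_relations n m) [inv_letter l] \<otimes>\<^bsub>U_group n m\<^esub> word_class (U_relations n m) [l] = \<one>\<^bsub>U_group n m\<^esub>"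
    unfolding U_mult U_one word_class_eq_iff
    using pres_eq.cancel[of "U_relations n m" "inv_letter l"] by simp
qed (rule U_word_closed)+

lemma U_rels:
  "Ua [^]\<^bsub>U_group n m\<^esub> (2 * n) = \<one>\<^bsub>U_group n m\<^esub>"
  "Ub [^]\<^bsub>U_group n m\<^esub> m = \<one>\<^bsub>U_group n m\<^esub>"
  "inv\<^bsub>U_group n m\<^esub> Ua \<otimes>\<^bsub>U_group n m\<^esub> Ub \<otimes>\<^bsub>U_group n m\<^esub> Ua = inv\<^bsub>U_group n m\<^esub> Ub"
  unfolding U_pow U_one U_inv U_mult word_class_eq_iff
  by (rule pres_eq.relation, simp add: U_relations_def)+

definition U_elt :: "int \<Rightarrow> int \<Rightarrow> ab word set" where
  "U_elt i j = Ua [^]\<^bsub>U_group n m\<^esub> i \<otimes>\<^bsub>U_group n m\<^esub> Ub [^]\<^bsub>U_group n m\<^esub> j"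

lemma U_elt_closed: "U_elt i j \<in> carrier (U_group n m)"
  by (simp add: U_elt_def U_word_closed)

lemma U_elt_mult: "U_elt i j \<otimes>\<^bsub>U_group n m\<^esub> U_elt k l = U_elt (i + k) (par_sign k * j + l)"
proof -
  note cl = U_word_closed U.int_pow_closed U.m_closed
  have "U_elt i j \<otimes>\<^bsub>U_group n m\<^esub> U_elt k l =
      Ua [^]\<^bsub>U_group n m\<^esub> i \<otimes>\<^bsub>U_group n m\<^esub>
      (Ub [^]\<^bsub>U_group n m\<^esub> j \<otimes>\<^bsub>U_group n m\<^esub> Ua [^]\<^bsub>U_group n m\<^esub> k) \<otimes>\<^bsub>U_group n m\<^esub>
      Ub [^]\<^bsub>U_group n m\<^esub> l"
    by (simp add: U_elt_def U.m_assoc cl)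
  also have "\<dots> = U_elt (i + k) (par_sign k * j + l)"
    by (simp add: U_elt_def U.inverting_int_pow_commute[OF U_word_closed U_word_closed U_rels(3)]
        U.int_pow_mult U.m_assoc cl)
  finally show ?thesis .
qed

text \<open>Every letter is a normal form, and \<open>U_elt_mult\<close> keeps products in normal
  form; induction on the word does the rest.\<close>

lemma U_carrier_iff: "x \<in> carrier (U_group n m) \<longleftrightarrow> (\<exists>i j. x = U_elt i j)"
proof
  assume "x \<in> carrier (U_group n m)"
  then obtain u where "x = word_class (U_relations n m) u"
    by (auto simp: U_carrier)
  moreover have "\<exists>i j. word_class (U_relations n m) u = U_elt i j"
  proof (induction u)
    case Nil
    have "word_class (U_relations n m) [] = U_elt 0 0"
      by (simp add: U_elt_def U_one[symmetric])
    thus ?case by blast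
  next
    case (Cons g u)
    then obtain i j where u: "word_class (U_relations n m) u = U_elt i j" by blast
    have "\<exists>k l. word_class (U_relations n m) [g] = U_elt k l"
    proof -
      have "Ua = U_elt 1 0" "Ub = U_elt 0 1"
        by (simp_all add: U_elt_def U_word_closed)
      moreover have "word_class (U_relations n m) [Neg gen_a] = U_elt (- 1) 0"
          "word_class (U_relations n m) [Neg gen_b] = U_elt 0 (- 1)"
        using U_inv[of "Pos gen_a"] U_inv[of "Pos gen_b"]
        by (simp_all add: U_elt_def U_word_closed U.int_pow_neg)
      ultimately show ?thesis
        by (cases g; metis ab.exhaust)
    qed
    then obtain k l where "word_class (U_relations n m) [g] = U_elt k l" by blast
    hence "word_class (U_relations n m) (g # u) = U_elt k l \<otimes>\<^bsub>U_group n m\<^esub> U_elt i j"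
      using U_mult[of "[g]" u] u by simp
    thus ?case unfolding U_elt_mult by blast
  qed
  ultimately show "\<exists>i j. x = U_elt i j" by blast
qed (auto simp: U_elt_closed)

text \<open>Congruent exponents give equal elements by the power relations. Conversely, von Dyck's
  theorem yields a homomorphism to \<open>U_model\<close>, which reads the residues of the exponents
  off an element.\<close>

lemma U_elt_eq_iff:
  assumes "n > 0" "m > 0"
  shows "U_elt i j = U_elt k l \<longleftrightarrow> 2 * int n dvd i - k \<and> int m dvd j - l"
proof
  assume eq: "U_elt i j = U_elt k l"
  interpret M: group "U_model n m" using assms by (rule U_model_group)
  \<comment> \<open>The generators go to the pairs for a and b, and the three relations hold for
    these images.\<close>
  define f where "f = case_ab (1 mod (2 * int n), 0::int) (0::int, 1 mod int m)"
  have f: "f gen_a = (1 mod (2 * int n), 0)" "f gen_b = (0, 1 mod int m)"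
    by (simp_all add: f_def)
  have fc: "f g \<in> carrier (U_model n m)" for g
    using assms by (cases g) (auto simp: f U_model_carrier)
  note pow = U_model_int_pow[OF assms]
  have word: "word_value (U_model n m) f (replicate r (Pos g)) = f g [^]\<^bsub>U_model n m\<^esub> int r" for r g
  proof -
    have "word_value (U_model n m) f (replicate r (Pos g)) = f g [^]\<^bsub>U_model n m\<^esub> r"
    proof (induction r)
      case (Suc r)
      thus ?case using M.nat_pow_Suc2[OF fc, of g r] by simp
    qed simp
    thus ?thesis by (simp add: int_pow_int)
  qed
  have "\<exists>h\<in>hom (presented_group (U_relations n m)) (U_model n m).
      \<forall>u. h (word_class (U_relations n m) u) = word_value (U_model n m) f u"
  proof (rule presented_group_universal[OF M.is_group])
    fix u v assume "(u, v) \<in> U_relations n m"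
    then consider "u = replicate (2 * n) (Pos gen_a)" "v = []"
      | "u = replicate m (Pos gen_b)" "v = []"
      | "u = [Neg gen_a, Pos gen_b, Pos gen_a]" "v = [Neg gen_b]"
      by (auto simp: U_relations_def)
    thus "word_value (U_model n m) f u = word_value (U_model n m) f v"
    proof cases
      case 1
      show ?thesis unfolding 1 word by (simp add: f pow U_model_one)
    next
      case 2
      show ?thesis unfolding 2 word by (simp add: f pow U_model_one)
    next
      case 3
      have "inv\<^bsub>U_model n m\<^esub> f gen_a = (- 1 mod (2 * int n), 0)"
        "inv\<^bsub>U_model n m\<^esub> f gen_b = (0, - 1 mod int m)"
        using pow[of "- 1"] M.int_pow_neg[OF fc, of gen_a 1] M.int_pow_neg[OF fc, of gen_b 1]
          M.int_pow_1[OF fc, of gen_a] M.int_pow_1[OF fc, of gen_b]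
        unfolding f by metis+
      thus ?thesis unfolding 3
        by (simp add: f U_model_mult U_model_one par_sign_def mod_simps dvd_mod_iff)
    qed
  qed (use fc in auto)
  then obtain h where hom: "h \<in> hom (U_group n m) (U_model n m)"
    and h: "\<And>u. h (word_class (U_relations n m) u) = word_value (U_model n m) f u"
    unfolding U_group_def by blast
  interpret h: group_hom "U_group n m" "U_model n m" h
    by unfold_locales (rule hom)
  have gens: "h Ua = (1 mod (2 * int n), 0)" "h Ub = (0, 1 mod int m)"
    using M.r_one[OF fc[of gen_a]] M.r_one[OF fc[of gen_b]] by (simp_all add: h f)
  have "h (U_elt i j) = (i mod (2 * int n), j mod int m)" for i j
    by (simp add: U_elt_def h.hom_int_pow U_word_closed gens pow U_model_mult)
  with eq show "2 * int n dvd i - k \<and> int m dvd j - l"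
    by (metis mod_eq_dvd_iff prod.inject)
next
  assume *: "2 * int n dvd i - k \<and> int m dvd j - l"
  then obtain p q where pq: "i = 2 * int n * p + k" "j = int m * q + l"
    by (metis dvd_def diff_add_cancel)
  have "Ua [^]\<^bsub>U_group n m\<^esub> (2 * int n * p) = \<one>\<^bsub>U_group n m\<^esub>"
    using U_rels(1) U.int_pow_pow[OF U_word_closed, of "[Pos gen_a]" "int (2 * n)" p]
    unfolding int_pow_int by (simp add: mult.commute)
  moreover have "Ub [^]\<^bsub>U_group n m\<^esub> (int m * q) = \<one>\<^bsub>U_group n m\<^esub>"
    using U_rels(2) U.int_pow_pow[OF U_word_closed, of "[Pos gen_b]" "int m" q]
    unfolding int_pow_int by (simp add: mult.commute)
  ultimately show "U_elt i j = U_elt k l"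
    by (simp add: pq U_elt_def U.int_pow_mult U_word_closed)
qed

lemma U_group_param:
  assumes "n > 0" "m \<ge> 3"
  shows "U_param (U_group n m) U_elt n m"
  by unfold_locales (use assms U_carrier_iff U_elt_mult U_elt_eq_iff in auto)

end

section \<open>Explicit formulas and comparison of the ratios\<close>

theorem theorem2p6:
  fixes m n :: nat
  assumes "m \<ge> 3" and "n \<ge> 2"
  defines "G \<equiv> U_group n m"
  defines "\<Gamma> \<equiv> ccc_graph G"
  shows
    "(even m \<and> even (m div 2) \<longrightarrow>
        real (zagreb1 \<Gamma>) = 1 / 8 * (16 * real n * (real n - 1)^2
          + (real m * real n - 2 * real n) * (real m * real n - 2 * real n - 2)^2)) \<and>
     (even m \<and> odd (m div 2) \<longrightarrow>
        real (zagreb1 \<Gamma>) = 1 / 8 * (16 * real n * (2 * real n - 1)^2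
          + (real m * real n - 2 * real n) * (real m * real n - 2 * real n - 2)^2)) \<and>
     (odd m \<longrightarrow>
        real (zagreb1 \<Gamma>) = 1 / 8 * (8 * real n * (real n - 1)^2
          + (real m * real n - real n) * (real m * real n - real n - 2)^2)) \<and>
     (even m \<and> even (m div 2) \<longrightarrow>
        real (zagreb2 \<Gamma>) = 1 / 32 * (32 * real n * (real n - 1)^3
          + (real m * real n - 2 * real n) * (real m * real n - 2 * real n - 2)^3)) \<and>
     (even m \<and> odd (m div 2) \<longrightarrow>
        real (zagreb2 \<Gamma>) = 1 / 32 * (32 * real n * (2 * real n - 1)^3
          + (real m * real n - 2 * real n) * (real m * real n - 2 * real n - 2)^3)) \<and>
     (odd m \<longrightarrow>
        real (zagreb2 \<Gamma>) = 1 / 32 * (16 * real n * (real n - 1)^3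
          + (real m * real n - real n) * (real m * real n - real n - 2)^3)) \<and>
     real (zagreb2 \<Gamma>) / real (card (edges \<Gamma>)) \<ge> real (zagreb1 \<Gamma>) / real (card (verts \<Gamma>)) \<and>
     (m = 3 \<or> m = 4 \<or> m = 6 \<longrightarrow>
        real (zagreb2 \<Gamma>) / real (card (edges \<Gamma>)) = real (zagreb1 \<Gamma>) / real (card (verts \<Gamma>)))"
proof -
  interpret U_param G "U_elt n m" n m
    unfolding G_def by (rule U_group_param) (use assms(1,2) in auto)
  \<comment> \<open>\<open>A\<close> and \<open>B\<close> count the vertices with even and with odd
    exponent of a.\<close>
  define A where "A = n * ((m - 1) div 2)"
  define B where "B = (if odd m then n else 2 * n)"
  \<comment> \<open>This makes the truncated difference \<open>A - 1\<close> agree with the real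
    one.\<close>
  have A: "A \<ge> 1" using assms(1,2) by (simp add: A_def)
  note Z = zagreb_regular_components[OF finite_verts_ccc edges_ccc_equal_deg, folded \<Gamma>_def]
  note R = zagreb_ratio_regular_components[OF finite_verts_ccc edges_ccc_equal_deg, folded \<Gamma>_def]
  note S = sum_verts_ccc[folded \<Gamma>_def A_def B_def]
  have z1: "real (zagreb1 \<Gamma>) = real A * (real A - 1)^2 + real B * real odd_deg ^ 2"
    using A arg_cong[OF S[of "\<lambda>d. d\<^sup>2"], of real] by (simp add: zagreb1_def)
  have z2: "2 * real (zagreb2 \<Gamma>) = real A * (real A - 1)^3 + real B * real odd_deg ^ 3"
    using A arg_cong[OF Z(2), of real] arg_cong[OF S[of "\<lambda>d. d ^ 3"], of real] by simp
  have Aodd: "2 * real A = real m * real n - real n" if "odd m"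
    using that assms(1) by (auto simp: A_def elim!: oddE) (simp add: algebra_simps)
  have Aeven: "2 * real A = real m * real n - 2 * real n" if "even m"
  proof -
    obtain h where h: "m = 2 * h" using \<open>even m\<close> by blast
    hence "(m - 1) div 2 = h - 1" "h \<ge> 1" using assms(1) by auto
    thus ?thesis by (simp add: A_def h of_nat_diff algebra_simps)
  qed
  have m4: "4 dvd m \<longleftrightarrow> even m \<and> even (m div 2)" by presburger
  have D1: "real odd_deg = real n - 1" if "\<not> (even m \<and> odd (m div 2))"
    using that assms(2) m4 by (auto simp: odd_deg_def of_nat_diff)
  have D2: "real odd_deg = 2 * real n - 1" if "even m \<and> odd (m div 2)"
    using that assms(2) m4 by (auto simp: odd_deg_def of_nat_diff)
  \<comment> \<open>The summands are rewritten in terms of 2A, which is mn - 2n or mn - n by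
    \<open>Aeven\<close> and \<open>Aodd\<close>.\<close>
  have z1': "real (zagreb1 \<Gamma>) = 2 * real A * (2 * real A - 2)^2 / 8 + real B * real odd_deg ^ 2"
    unfolding z1 by (simp add: power2_eq_square field_simps)
  have z2': "real (zagreb2 \<Gamma>) = 2 * real A * (2 * real A - 2)^3 / 32 + real B * real odd_deg ^ 3 / 2"
    using z2 by (simp add: power3_eq_cube field_simps)
  have eq: "deg \<Gamma> v = A - 1" if "m = 3 \<or> m = 4 \<or> m = 6" "v \<in> verts \<Gamma>" for v
  proof -
    \<comment> \<open>For m = 3 and m = 4 all cliques have size n, for m = 6 both have size 2n. The
      graph is regular in these cases, hence the equality.\<close>
    have "odd_deg = A - 1" using that(1) by (auto simp: odd_deg_def A_def)
    moreover have "v \<in> cls ` (idx_even \<union> idx_odd)"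
      using that(2) verts_ccc by (simp add: \<Gamma>_def idx_def)
    ultimately show ?thesis
      using deg_cls_even deg_cls_odd by (auto simp: \<Gamma>_def A_def)
  qed
  show ?thesis
  proof (intro conjI impI)
    assume *: "even m \<and> even (m div 2)"
    show "real (zagreb1 \<Gamma>) = 1 / 8 * (16 * real n * (real n - 1)^2
          + (real m * real n - 2 * real n) * (real m * real n - 2 * real n - 2)^2)"
      using * z1' by (simp add: Aeven D1 B_def)
    show "real (zagreb2 \<Gamma>) = 1 / 32 * (32 * real n * (real n - 1)^3
          + (real m * real n - 2 * real n) * (real m * real n - 2 * real n - 2)^3)"
      using * z2' by (simp add: Aeven D1 B_def)
  next
    assume *: "even m \<and> odd (m div 2)"
    show "real (zagreb1 \<Gamma>) = 1 / 8 * (16 * real n * (2 * real n - 1)^2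
          + (real m * real n - 2 * real n) * (real m * real n - 2 * real n - 2)^2)"
      using * z1' by (simp add: Aeven D2 B_def)
    show "real (zagreb2 \<Gamma>) = 1 / 32 * (32 * real n * (2 * real n - 1)^3
          + (real m * real n - 2 * real n) * (real m * real n - 2 * real n - 2)^3)"
      using * z2' by (simp add: Aeven D2 B_def)
  next
    assume *: "odd m"
    show "real (zagreb1 \<Gamma>) = 1 / 8 * (8 * real n * (real n - 1)^2
          + (real m * real n - real n) * (real m * real n - real n - 2)^2)"
      using * z1' by (simp add: Aodd D1 B_def)
    show "real (zagreb2 \<Gamma>) = 1 / 32 * (16 * real n * (real n - 1)^3
          + (real m * real n - real n) * (real m * real n - real n - 2)^3)"
      using * z2' by (simp add: Aodd D1 B_def)
  next
    show "real (zagreb2 \<Gamma>) / real (card (edges \<Gamma>)) \<ge> real (zagreb1 \<Gamma>) / real (card (verts \<Gamma>))"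
      by (rule R(1))
  next
    assume *: "m = 3 \<or> m = 4 \<or> m = 6"
    show "real (zagreb2 \<Gamma>) / real (card (edges \<Gamma>)) = real (zagreb1 \<Gamma>) / real (card (verts \<Gamma>))"
      by (rule R(2)[OF _ eq[OF *]])
  qed
qed

end
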